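(* Let $R$ be a nonvoid relation on $X\times Y$. Suppose $P_R$ has reduced integral homology in dimension $k\geq0$, that is, $\widetilde H_k(\Delta(P_R);\mathbb{Z})\ne 0$. Then there are at least $(k+2)!$ maximal chains in $P_R$ of length at least $k$.
   Context: Everything is finite. A relation $R$ on $X\times Y$ is a subset of $X\times Y$; it is nonvoid if $X\neq\emptyset$ and $Y\ne\emptyset$. $Y_x=\{y\in Y:(x,y)\in R\}$ and $X_y=\{x\in X:(x,y)\in R\}$. For $\sigma\subseteq X$, $\phi_R(\sigma)=\bigcap_{x\in\sigma}Y_x$ with $\phi_R(\emptyset)=Y$; for $\gamma\subseteq Y$, $\psi_R(\gamma)=\bigcap_{y\in\gamma}X_y$ with $\psi_R(\emptyset)=X$. The doubly-labeled poset $P_R$ consists of all pairs $(\sigma,\gamma)$ with $\emptyset\neq\sigma\subseteq X$, $\emptyset\ne\gamma\subseteq Y$, $\sigma=\psi_R(\gamma)$ and $\gamma=\phi_R(\sigma)$, ordered by $(\sigma_1,\gamma_1)\le(\sigma_2,\gamma_2)$ iff $\sigma_1\subseteq\sigma_2$ (equivalently $\gamma_1\supseteq\gamma_2$). $\Delta(P)$ is the order complex of a poset $P$ (simplices are the chains of $P$). The length of a chain is one less than its number of elements. $\widetilde H_k$ denotes reduced simplicial homology. *)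

theory Defs
  imports "HOL-Algebra.Free_Abelian_Groups"
begin

section \<open>The doubly-labeled poset of a relation\<close>

text \<open>Intersecting with \<open>Y\<close> (resp. \<open>X\<close>) only matters for the empty index set, where it
  gives \<open>rel_phi X Y R {} = Y\<close> (resp. \<open>rel_psi X Y R {} = X\<close>).\<close>

definition rel_phi :: "'a set \<Rightarrow> 'b set \<Rightarrow> ('a \<times> 'b) set \<Rightarrow> 'a set \<Rightarrow> 'b set" where
  "rel_phi X Y R \<sigma> = Y \<inter> (\<Inter>x\<in>\<sigma>. {y \<in> Y. (x, y) \<in> R})"

definition rel_psi :: "'a set \<Rightarrow> 'b set \<Rightarrow> ('a \<times> 'b) set \<Rightarrow> 'b set \<Rightarrow> 'a set" where
  "rel_psi X Y R \<gamma> = X \<inter> (\<Inter>y\<in>\<gamma>. {x \<in> X. (x, y) \<in> R})"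

definition doubly_labeled_poset ::
    "'a set \<Rightarrow> 'b set \<Rightarrow> ('a \<times> 'b) set \<Rightarrow> ('a set \<times> 'b set) set" where
  "doubly_labeled_poset X Y R =
     {(\<sigma>, \<gamma>). \<sigma> \<noteq> {} \<and> \<sigma> \<subseteq> X \<and> \<gamma> \<noteq> {} \<and> \<gamma> \<subseteq> Y \<and> \<sigma> = rel_psi X Y R \<gamma> \<and> \<gamma> = rel_phi X Y R \<sigma>}"

definition label_le :: "'a set \<times> 'b set \<Rightarrow> 'a set \<times> 'b set \<Rightarrow> bool" where
  "label_le p q \<longleftrightarrow> fst p \<subseteq> fst q"

section \<open>Chains and the order complex\<close>

text \<open>The length takes values in \<^typ>\<open>int\<close> so that the empty chain has length \<open>-1\<close>.\<close>

definition chain_length :: "'v set \<Rightarrow> int" where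
  "chain_length C = int (card C) - 1"

text \<open>The empty chain is included: it is the \<open>(-1)\<close>-dimensional simplex used for augmentation.\<close>

definition order_complex :: "'v set \<Rightarrow> ('v \<Rightarrow> 'v \<Rightarrow> bool) \<Rightarrow> 'v set set" where
  "order_complex P r = {C. finite C \<and> pred_on.chain P r C}"

section \<open>Reduced simplicial homology\<close>

text \<open>
  Let \<open>K\<close> be an abstract simplicial complex, the empty simplex included, and let \<open>r\<close> be a relation
  that restricts to a total order on every simplex of \<open>K\<close>.  An oriented simplex is represented by
  the list of its vertices in increasing order, so each simplex has exactly one representative.
  The index \<open>n\<close> counts vertices: the simplices of dimension \<open>k\<close> are those with \<open>n = k + 1\<close>.
\<close>

definition ordered_simplices :: "'v set set \<Rightarrow> ('v \<Rightarrow> 'v \<Rightarrow> bool) \<Rightarrow> nat \<Rightarrow> 'v list set" where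
  "ordered_simplices K r n =
     {vs. length vs = n \<and> distinct vs \<and> sorted_wrt r vs \<and> set vs \<in> K}"

definition simplicial_chain_group ::
    "'v set set \<Rightarrow> ('v \<Rightarrow> 'v \<Rightarrow> bool) \<Rightarrow> nat \<Rightarrow> ('v list \<Rightarrow>\<^sub>0 int) monoid" where
  "simplicial_chain_group K r n = free_Abelian_group (ordered_simplices K r n)"

definition delete_nth :: "nat \<Rightarrow> 'v list \<Rightarrow> 'v list" where
  "delete_nth i vs = take i vs @ drop (Suc i) vs"

text \<open>On a single vertex this is the augmentation, \<open>[v] \<mapsto> []\<close>.\<close>

definition simplicial_boundary :: "('v list \<Rightarrow>\<^sub>0 int) \<Rightarrow> ('v list \<Rightarrow>\<^sub>0 int)" where
  "simplicial_boundary =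
     frag_extend (\<lambda>vs. \<Sum>i<length vs. frag_cmul ((-1) ^ i) (frag_of (delete_nth i vs)))"

definition cycles :: "'v set set \<Rightarrow> ('v \<Rightarrow> 'v \<Rightarrow> bool) \<Rightarrow> nat \<Rightarrow> ('v list \<Rightarrow>\<^sub>0 int) set" where
  "cycles K r k =
     kernel (simplicial_chain_group K r (k + 1)) (simplicial_chain_group K r k) simplicial_boundary"

definition boundaries :: "'v set set \<Rightarrow> ('v \<Rightarrow> 'v \<Rightarrow> bool) \<Rightarrow> nat \<Rightarrow> ('v list \<Rightarrow>\<^sub>0 int) set" where
  "boundaries K r k = simplicial_boundary ` carrier (simplicial_chain_group K r (k + 2))"

definition reduced_homology_group ::
    "'v set set \<Rightarrow> ('v \<Rightarrow> 'v \<Rightarrow> bool) \<Rightarrow> nat \<Rightarrow> ('v list \<Rightarrow>\<^sub>0 int) set monoid" where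
  "reduced_homology_group K r k =
     subgroup_generated (simplicial_chain_group K r (k + 1)) (cycles K r k) Mod boundaries K r k"

subsection \<open>The homology groups are well defined\<close>

lemma delete_nth_swap:
  assumes "i \<le> j" "Suc j < length vs"
  shows "delete_nth i (delete_nth (Suc j) vs) = delete_nth j (delete_nth i vs)"
  using assms
  by (intro nth_equalityI) (auto simp: delete_nth_def nth_append min_def)

lemma length_delete_nth: "i < length vs \<Longrightarrow> length (delete_nth i vs) = length vs - 1"
  by (simp add: delete_nth_def)

lemma simplicial_boundary_of:
  "simplicial_boundary (frag_of vs) =
     (\<Sum>i<length vs. frag_cmul ((-1) ^ i) (frag_of (delete_nth i vs)))"
  by (simp add: simplicial_boundary_def)

lemma simplicial_boundary_diff:
  "simplicial_boundary (a - b) = simplicial_boundary a - simplicial_boundary b"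
  by (simp add: simplicial_boundary_def frag_extend_diff)

lemma simplicial_boundary_boundary: "simplicial_boundary (simplicial_boundary c) = 0"
proof -
  have "Poly_Mapping.keys c \<subseteq> UNIV" by simp
  then show ?thesis
  proof (induction rule: frag_induction)
    case zero
    show ?case by (simp add: simplicial_boundary_def)
  next
    case (one vs)
    define n where "n = length vs"
    define f where
      "f = (\<lambda>(i, j). frag_cmul ((-1) ^ (i + j)) (frag_of (delete_nth j (delete_nth i vs))))"
    let ?D = "{..<n} \<times> {..<n - 1}"
    let ?A = "{(i, j). j < i \<and> i < n}" and ?B = "{(i, j). i \<le> j \<and> j < n - 1}"
    have fin: "finite ?A" "finite ?B"
      by (rule finite_subset[of _ "{..n} \<times> {..n}"]; auto)+
    have "simplicial_boundary (simplicial_boundary (frag_of vs)) =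
        (\<Sum>i<n. frag_cmul ((-1) ^ i) (simplicial_boundary (frag_of (delete_nth i vs))))"
      unfolding simplicial_boundary_of n_def
      by (simp add: simplicial_boundary_def frag_extend_sum frag_extend_cmul)
    also have "\<dots> = (\<Sum>i<n. \<Sum>j<n - 1. f (i, j))"
      unfolding simplicial_boundary_of
      by (intro sum.cong) (auto simp: f_def n_def length_delete_nth frag_cmul_sum power_add)
    also have "\<dots> = sum f ?D"
      by (simp add: sum.cartesian_product)
    also have "?D = ?A \<union> ?B"
      by auto
    also have "sum f (?A \<union> ?B) = sum f ?A + sum f ?B"
      by (intro sum.union_disjoint fin) auto
    also have "?A = (\<lambda>(i, j). (Suc j, i)) ` ?B"
      by (auto simp: image_iff) (metis One_nat_def Suc_pred less_Suc_eq_le less_diff_conv add.commute plus_1_eq_Suc less_nat_zero_code not_gr_zero)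
    also have "sum f \<dots> = (\<Sum>(i, j)\<in>?B. f (Suc j, i))"
      by (subst sum.reindex) (auto simp: inj_on_def case_prod_unfold)
    also have "\<dots> = (\<Sum>p\<in>?B. - f p)"
    proof (intro sum.cong refl, clarify)
      fix i j assume "i \<le> j" "j < n - 1"
      then have "delete_nth i (delete_nth (Suc j) vs) = delete_nth j (delete_nth i vs)"
        by (intro delete_nth_swap) (auto simp: n_def)
      then show "f (Suc j, i) = - f (i, j)"
        by (simp add: f_def add.commute)
    qed
    also have "\<dots> + sum f ?B = 0"
      by (simp add: sum_negf)
    finally show ?case .
  next
    case (diff a b)
    then show ?case by (simp add: simplicial_boundary_diff)
  qed
qed

text \<open>All faces of simplices are simplices, hence boundaries are cycles and the quotient is a group.\<close>

lemma simplicial_boundary_closed: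
  assumes K: "\<And>S T. S \<in> K \<Longrightarrow> T \<subseteq> S \<Longrightarrow> T \<in> K"
    and c: "c \<in> carrier (simplicial_chain_group K r (Suc n))"
  shows "simplicial_boundary c \<in> carrier (simplicial_chain_group K r n)"
proof -
  have "Poly_Mapping.keys c \<subseteq> ordered_simplices K r (Suc n)"
    using c by (simp add: simplicial_chain_group_def)
  then show ?thesis
  proof (induction rule: frag_induction)
    case zero
    show ?case by (simp add: simplicial_boundary_def simplicial_chain_group_def)
  next
    case (one vs)
    have "frag_of (delete_nth i vs) \<in> carrier (simplicial_chain_group K r n)" if "i < length vs" for i
    proof -
      have "distinct (take i vs @ vs ! i # drop (Suc i) vs)"
          "sorted_wrt r (take i vs @ vs ! i # drop (Suc i) vs)"
        using one that by (simp_all add: ordered_simplices_def flip: id_take_nth_drop)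
      then have "distinct (delete_nth i vs)" "sorted_wrt r (delete_nth i vs)"
        by (auto simp: delete_nth_def sorted_wrt_append)
      moreover have "set (delete_nth i vs) \<subseteq> set vs"
        by (auto simp: delete_nth_def dest: in_set_takeD in_set_dropD)
      ultimately show ?thesis
        using one K that
        by (auto simp: simplicial_chain_group_def ordered_simplices_def length_delete_nth)
    qed
    then show ?case
      unfolding simplicial_boundary_of simplicial_chain_group_def
      by (intro sum_closed_free_Abelian_group) (auto simp: keys_cmul_iff)
  next
    case (diff a b)
    then show ?case
      using keys_diff by (fastforce simp: simplicial_chain_group_def simplicial_boundary_diff)
  qed
qed

lemma group_hom_simplicial_boundary:
  assumes "\<And>S T. S \<in> K \<Longrightarrow> T \<subseteq> S \<Longrightarrow> T \<in> K"
  shows "group_hom (simplicial_chain_group K r (Suc n)) (simplicial_chain_group K r n)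
           simplicial_boundary"
proof -
  have "simplicial_boundary
      \<in> hom (simplicial_chain_group K r (Suc n)) (simplicial_chain_group K r n)"
    using simplicial_boundary_closed[OF assms]
    by (intro homI) (auto simp: simplicial_chain_group_def simplicial_boundary_def frag_extend_add)
  then show ?thesis
    by (simp add: group_hom_def group_hom_axioms_def simplicial_chain_group_def)
qed

lemma group_reduced_homology_group:
  assumes K: "\<And>S T. S \<in> K \<Longrightarrow> T \<subseteq> S \<Longrightarrow> T \<in> K"
  shows "group (reduced_homology_group K r k)"
proof -
  let ?C = "simplicial_chain_group K r" and ?Z = "cycles K r k" and ?B = "boundaries K r k"
  interpret d1: group_hom "?C (Suc k)" "?C k" simplicial_boundary
    by (rule group_hom_simplicial_boundary[OF K])
  interpret d2: group_hom "?C (Suc (Suc k))" "?C (Suc k)" simplicial_boundary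
    by (rule group_hom_simplicial_boundary[OF K])
  have Z: "subgroup ?Z (?C (Suc k))"
    unfolding cycles_def using d1.subgroup_kernel by simp
  have B: "subgroup ?B (?C (Suc k))"
    unfolding boundaries_def using d2.img_is_subgroup by simp
  have "?B \<subseteq> ?Z"
    using d2.hom_closed
    by (auto simp: boundaries_def cycles_def kernel_def simplicial_boundary_boundary)
       (simp add: simplicial_chain_group_def)
  then have "subgroup ?B (subgroup_generated (?C (Suc k)) ?Z)"
    using d1.G.subgroup_of_subgroup_generated[OF _ B] by simp
  moreover have "comm_group (subgroup_generated (?C (Suc k)) ?Z)"
    unfolding simplicial_chain_group_def
    by (intro group.abelian_subgroup_generated abelian_free_Abelian_group group_free_Abelian_group)
  ultimately have "?B \<lhd> subgroup_generated (?C (Suc k)) ?Z"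
    by (simp add: comm_group.normal_iff_subgroup)
  then show ?thesis
    by (simp add: reduced_homology_group_def normal.factorgroup_is_group)
qed

lemma order_complex_subset: "S \<in> order_complex P r \<Longrightarrow> T \<subseteq> S \<Longrightarrow> T \<in> order_complex P r"
  by (auto simp: order_complex_def pred_on.chain_def intro: finite_subset)

end

theory Submission
  imports Defs
begin

text \<open>
  In \<open>P\<^sub>R\<close> any two elements with a common upper bound have a join, because the \<open>\<gamma>\<close>-labels are closed
  under nonempty intersection.  This property is inherited by up-closed subsets, which allows an
  induction over all such posets \<open>P\<close>.  Suppose that \<open>P\<close> has homology in dimension \<open>k\<close>.  If the
  strict up-set of some minimal \<open>m\<close> has none in dimension \<open>k - 1\<close>, then by Mayer--Vietoris (the
  closed up-set of \<open>m\<close> is a cone) \<open>P - {m}\<close> still has homology in dimension \<open>k\<close>, and deleting \<open>m\<close>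
  does not increase the number of long maximal chains.  Otherwise every minimal element starts at
  least \<open>(k + 1)!\<close> long maximal chains.  There are at least \<open>k + 2\<close> minimal elements: splitting off
  one principal up-set at a time, whose intersections with the others are again principal,
  Mayer--Vietoris shows that a union of at most \<open>k + 1\<close> principal up-sets has no homology in
  dimension \<open>k\<close>.
\<close>

section \<open>Acyclicity of order complexes\<close>

text \<open>As in \<^const>\<open>ordered_simplices\<close>, the index \<open>n\<close> counts vertices, so \<open>acyclic_at r P n\<close> says
  that the reduced homology of the order complex of \<open>P\<close> vanishes in dimension \<open>n - 1\<close>.\<close>

definition chain_lists :: "('v \<Rightarrow> 'v \<Rightarrow> bool) \<Rightarrow> 'v set \<Rightarrow> nat \<Rightarrow> 'v list set" where
  "chain_lists r P n = {vs. length vs = n \<and> distinct vs \<and> sorted_wrt r vs \<and> set vs \<subseteq> P}"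

definition acyclic_at :: "('v \<Rightarrow> 'v \<Rightarrow> bool) \<Rightarrow> 'v set \<Rightarrow> nat \<Rightarrow> bool" where
  "acyclic_at r P n \<longleftrightarrow>
     (\<forall>c. Poly_Mapping.keys c \<subseteq> chain_lists r P n \<and> simplicial_boundary c = 0 \<longrightarrow>
       (\<exists>d. Poly_Mapping.keys d \<subseteq> chain_lists r P (Suc n) \<and> simplicial_boundary d = c))"

text \<open>For such a \<open>Q\<close>, a sorted list from \<open>P\<close> lies in
  \<open>Q\<close> as soon as its first entry does.\<close>

definition up_closed_in :: "('v \<Rightarrow> 'v \<Rightarrow> bool) \<Rightarrow> 'v set \<Rightarrow> 'v set \<Rightarrow> bool" where
  "up_closed_in r P Q \<longleftrightarrow> Q \<subseteq> P \<and> (\<forall>x\<in>Q. \<forall>y\<in>P. r x y \<longrightarrow> y \<in> Q)"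

section \<open>Simplices of the order complex as sorted lists\<close>

lemma ordered_simplices_order_complex:
  "ordered_simplices (order_complex P r) r n = chain_lists r P n"
proof -
  have "pred_on.chain P r (set vs)" if "sorted_wrt r vs" "set vs \<subseteq> P" for vs
  unfolding pred_on.chain_def
  proof (intro conjI ballI)
    fix x y assume "x \<in> set vs" "y \<in> set vs"
    then obtain i j where ij: "i < length vs" "j < length vs" "x = vs ! i" "y = vs ! j"
      by (auto simp: in_set_conv_nth)
    with that(1) show "r\<^sup>=\<^sup>= x y \<or> r\<^sup>=\<^sup>= y x"
      by (cases i j rule: linorder_cases) (auto simp: sorted_wrt_iff_nth_less)
  qed (use that in auto)
  then show ?thesis
    by (auto simp: ordered_simplices_def order_complex_def chain_lists_def pred_on.chain_def)
qed

lemma simplicial_boundary_add: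
  "simplicial_boundary (a + b) = simplicial_boundary a + simplicial_boundary b"
  by (simp add: simplicial_boundary_def frag_extend_add)

lemma keys_simplicial_boundary:
  assumes "Poly_Mapping.keys c \<subseteq> chain_lists r P (Suc n)"
  shows "Poly_Mapping.keys (simplicial_boundary c) \<subseteq> chain_lists r P n"
  using simplicial_boundary_closed[of "order_complex P r" c r n] assms order_complex_subset
  by (metis carrier_free_Abelian_group_iff ordered_simplices_order_complex
      simplicial_chain_group_def)

section \<open>Contraction of cones\<close>

lemma simplicial_boundary_Cons:
  "simplicial_boundary (frag_of (m # vs)) =
     frag_of vs - frag_extend (\<lambda>us. frag_of (m # us)) (simplicial_boundary (frag_of vs))"
proof -
  have "simplicial_boundary (frag_of (m # vs)) =
      frag_of vs + (\<Sum>i<length vs. frag_cmul ((-1) ^ Suc i) (frag_of (m # delete_nth i vs)))"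
    unfolding simplicial_boundary_of length_Cons sum.lessThan_Suc_shift
    by (simp add: delete_nth_def)
  \<comment> \<open>Deleting a later entry keeps \<open>m\<close> in front and raises the index by
    one, which flips the sign.\<close>
  also have "(\<Sum>i<length vs. frag_cmul ((-1) ^ Suc i) (frag_of (m # delete_nth i vs))) =
      - frag_extend (\<lambda>us. frag_of (m # us)) (simplicial_boundary (frag_of vs))"
    unfolding simplicial_boundary_of
    by (simp add: frag_extend_sum frag_extend_cmul minus_frag_cmul flip: sum_negf)
  finally show ?thesis by simp
qed

text \<open>Prepending \<open>m\<close> to the lists that avoid it is a contracting homotopy
  \<open>h\<close>, so a cycle \<open>c\<close> is the boundary of \<open>h c\<close>. This includes
  \<open>n = 0\<close>, where \<open>[]\<close> is the boundary of \<open>[m]\<close>.\<close>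

lemma acyclic_at_cone:
  assumes anti: "antisymp_on P r" and m: "m \<in> P" "\<And>x. x \<in> P \<Longrightarrow> r m x"
  shows "acyclic_at r P n"
  unfolding acyclic_at_def
proof (intro allI impI, elim conjE)
  define h where "h = frag_extend (\<lambda>vs. if m \<in> set vs then 0 else frag_of (m # vs))"
  \<comment> \<open>A least element can only be the first entry: if it came later, antisymmetry
    would identify it with the first one.\<close>
  have head: "m \<notin> set vs \<or> (\<exists>us. vs = m # us \<and> m \<notin> set us)" if "vs \<in> chain_lists r P n" for vs
  proof (cases vs)
    case (Cons v us)
    have "m = v" if "m \<in> set us"
      using \<open>vs \<in> _\<close> Cons that m anti unfolding antisymp_on_def chain_lists_def by auto
    then show ?thesis using Cons that by (auto simp: chain_lists_def)
  qed auto
  have del: "set (delete_nth i vs) \<subseteq> set vs" for i and vs :: "'a list"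
    by (auto simp: delete_nth_def dest: in_set_takeD in_set_dropD)
  have keys_bd: "m \<notin> set us" if "us \<in> Poly_Mapping.keys (simplicial_boundary (frag_of vs))" "m \<notin> set vs" for us vs
  proof -
    have "us \<in> (\<Union>i\<in>{..<length vs}. Poly_Mapping.keys (frag_cmul ((-1) ^ i) (frag_of (delete_nth i vs))))"
      using that(1) keys_sum unfolding simplicial_boundary_of by fastforce
    then show ?thesis using that(2) del by (force simp: keys_cmul_iff)
  qed
  have h_eq: "h (simplicial_boundary (frag_of vs)) =
      frag_extend (\<lambda>us. frag_of (m # us)) (simplicial_boundary (frag_of vs))" if "m \<notin> set vs" for vs
    unfolding h_def by (rule frag_extend_eq) (use keys_bd that in auto)
  have homotopy: "simplicial_boundary (h c) + h (simplicial_boundary c) = c"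
    if "Poly_Mapping.keys c \<subseteq> chain_lists r P n" for c
    using that
  proof (induction rule: frag_induction)
    case zero
    then show ?case by (simp add: h_def simplicial_boundary_def)
  next
    case (one vs)
    from head[OF one] show ?case
    proof
      assume "m \<notin> set vs"
      then show ?thesis
        using h_eq[of vs] by (simp add: h_def simplicial_boundary_Cons)
    next
      assume "\<exists>us. vs = m # us \<and> m \<notin> set us"
      then obtain us where us: "vs = m # us" "m \<notin> set us" by blast
      \<comment> \<open>The lists in \<open>h (simplicial_boundary (frag_of us))\<close> start with
        \<open>m\<close>, and \<open>h\<close> vanishes on lists containing
        \<open>m\<close>.\<close>
      have "h (h (simplicial_boundary (frag_of us))) = 0"
        unfolding h_eq[OF us(2)]
        using keys_frag_extend[of "\<lambda>us. frag_of (m # us)" "simplicial_boundary (frag_of us)"]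
        by (auto simp: h_def intro!: frag_extend_eq_0)
      then show ?thesis
        using us h_eq[of us] by (simp add: simplicial_boundary_Cons h_def frag_extend_diff)
          (simp add: simplicial_boundary_def)
    qed
  next
    case (diff a b)
    then show ?case
      by (simp add: simplicial_boundary_diff h_def frag_extend_diff algebra_simps)
  qed
  fix c assume c: "Poly_Mapping.keys c \<subseteq> chain_lists r P n" "simplicial_boundary c = 0"
  have "Poly_Mapping.keys (h c) \<subseteq> chain_lists r P (Suc n)"
    unfolding h_def
  proof (rule order_trans[OF keys_frag_extend], rule UN_least)
    fix vs assume "vs \<in> Poly_Mapping.keys c"
    then have "vs \<in> chain_lists r P n" using c(1) by blast
    then show "Poly_Mapping.keys (if m \<in> set vs then 0 else frag_of (m # vs))
        \<subseteq> chain_lists r P (Suc n)"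
      using m by (auto simp: chain_lists_def)
  qed
  moreover have "simplicial_boundary (h c) = c"
    using homotopy[OF c(1)] c(2) by (simp add: h_def)
  ultimately show "\<exists>d. Poly_Mapping.keys d \<subseteq> chain_lists r P (Suc n) \<and> simplicial_boundary d = c"
    by blast
qed

text \<open>The part of the Mayer--Vietoris sequence around the homology of \<open>A \<union> B\<close>.\<close>

lemma acyclic_at_Un:
  assumes A: "acyclic_at r A (Suc n)" "up_closed_in r (A \<union> B) A"
    and B: "acyclic_at r B (Suc n)" "up_closed_in r (A \<union> B) B"
    and AB: "acyclic_at r (A \<inter> B) n"
  shows "acyclic_at r (A \<union> B) (Suc n)"
  unfolding acyclic_at_def
proof (intro allI impI, elim conjE)
  fix c
  assume c: "Poly_Mapping.keys c \<subseteq> chain_lists r (A \<union> B) (Suc n)" "simplicial_boundary c = 0"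
  \<comment> \<open>The least vertex of a simplex decides, by up-closedness, in which part the whole
    simplex lies.\<close>
  have "chain_lists r (A \<union> B) (Suc n) \<subseteq> chain_lists r A (Suc n) \<union> chain_lists r B (Suc n)"
  proof
    fix vs assume vs: "vs \<in> chain_lists r (A \<union> B) (Suc n)"
    then obtain v us where "vs = v # us" by (cases vs) (auto simp: chain_lists_def)
    with vs have v: "v \<in> A \<or> v \<in> B" and us: "\<forall>u\<in>set us. r v u \<and> u \<in> A \<union> B"
      by (auto simp: chain_lists_def)
    have "set vs \<subseteq> A \<or> set vs \<subseteq> B"
      using v us A(2) B(2) \<open>vs = v # us\<close> unfolding up_closed_in_def
      by (metis UnI1 UnI2 set_ConsD subsetI)
    with vs show "vs \<in> chain_lists r A (Suc n) \<union> chain_lists r B (Suc n)"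
      by (simp add: chain_lists_def)
  qed
  with c(1) obtain a b where a: "Poly_Mapping.keys a \<subseteq> chain_lists r A (Suc n)"
    and b: "Poly_Mapping.keys b \<subseteq> chain_lists r B (Suc n)" and ab: "a + b = c"
    by (meson frag_split order_trans)
  have bd: "simplicial_boundary a = - simplicial_boundary b"
    using c(2) unfolding ab[symmetric] simplicial_boundary_add eq_neg_iff_add_eq_0 .
  have "Poly_Mapping.keys (simplicial_boundary a) \<subseteq> chain_lists r A n \<inter> chain_lists r B n"
    using keys_simplicial_boundary[OF a] keys_simplicial_boundary[OF b] bd by auto
  also have "\<dots> = chain_lists r (A \<inter> B) n"
    by (auto simp: chain_lists_def)
  \<comment> \<open>\<open>e\<close> repairs the splitting: \<open>a - e\<close> and
    \<open>b + e\<close> are cycles in \<open>A\<close> and \<open>B\<close>, and they still add up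
    to \<open>c\<close>.\<close>
  finally obtain e where e: "Poly_Mapping.keys e \<subseteq> chain_lists r (A \<inter> B) (Suc n)"
    "simplicial_boundary e = simplicial_boundary a"
    using AB simplicial_boundary_boundary unfolding acyclic_at_def by metis
  have eA: "Poly_Mapping.keys e \<subseteq> chain_lists r A (Suc n)"
    and eB: "Poly_Mapping.keys e \<subseteq> chain_lists r B (Suc n)"
    using e(1) by (auto simp: chain_lists_def)
  obtain f where f: "Poly_Mapping.keys f \<subseteq> chain_lists r A (Suc (Suc n))"
      "simplicial_boundary f = a - e"
  proof -
    have "Poly_Mapping.keys (a - e) \<subseteq> chain_lists r A (Suc n)"
      using keys_diff[of a e] a eA by blast
    then show ?thesis
      using A(1) that e(2) by (auto simp: acyclic_at_def simplicial_boundary_diff)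
  qed
  obtain g where g: "Poly_Mapping.keys g \<subseteq> chain_lists r B (Suc (Suc n))"
      "simplicial_boundary g = b + e"
  proof -
    have "Poly_Mapping.keys (b + e) \<subseteq> chain_lists r B (Suc n)"
      using keys_add[of b e] b eB by blast
    moreover have "simplicial_boundary (b + e) = 0"
      using e(2) bd by (simp add: simplicial_boundary_add)
    ultimately show ?thesis
      using B(1) that by (auto simp: acyclic_at_def)
  qed
  have "Poly_Mapping.keys (f + g) \<subseteq> chain_lists r (A \<union> B) (Suc (Suc n))"
    using keys_add[of f g] f(1) g(1) by (auto simp: chain_lists_def)
  moreover have "simplicial_boundary (f + g) = c"
    using f(2) g(2) ab by (simp add: simplicial_boundary_add)
  ultimately show "\<exists>d. Poly_Mapping.keys d \<subseteq> chain_lists r (A \<union> B) (Suc (Suc n)) \<and>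
      simplicial_boundary d = c"
    by blast
qed

text \<open>At index 0 this would fail: \<open>[]\<close> is a cycle, and over the empty set there
  is no longer list to bound it.\<close>

lemma acyclic_at_empty: "acyclic_at r {} (Suc n)"
proof -
  have "chain_lists r {} (Suc n) = {}"
    by (auto simp: chain_lists_def)
  then show ?thesis
    by (auto simp: acyclic_at_def simplicial_boundary_def intro!: exI[of _ 0])
qed

text \<open>Boundaries and cycles coincide, so the quotient is by the whole carrier and has a single
  coset.\<close>

lemma trivial_reduced_homology_group:
  assumes "acyclic_at r P (Suc k)"
  shows "trivial_group (reduced_homology_group (order_complex P r) r k)"
proof -
  let ?K = "order_complex P r"
  let ?C = "simplicial_chain_group ?K r" and ?Z = "cycles ?K r k"
  interpret d: group_hom "?C (Suc k)" "?C k" simplicial_boundary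
    by (rule group_hom_simplicial_boundary[OF order_complex_subset])
  interpret d2: group_hom "?C (Suc (Suc k))" "?C (Suc k)" simplicial_boundary
    by (rule group_hom_simplicial_boundary[OF order_complex_subset])
  have C: "carrier (?C n) = {c. Poly_Mapping.keys c \<subseteq> chain_lists r P n}" "\<one>\<^bsub>?C n\<^esub> = 0" for n
    by (auto simp: simplicial_chain_group_def ordered_simplices_order_complex)
  have Z: "subgroup ?Z (?C (Suc k))"
    unfolding cycles_def using d.subgroup_kernel by simp
  have "boundaries ?K r k = ?Z"
    using assms d2.hom_closed
    by (auto simp: boundaries_def cycles_def kernel_def C acyclic_at_def
        simplicial_boundary_boundary)
  also have "\<dots> = carrier (subgroup_generated (?C (Suc k)) ?Z)"
    using subgroup.carrier_subgroup_generated_subgroup[OF Z] by simp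
  finally have eq: "reduced_homology_group ?K r k =
      subgroup_generated (?C (Suc k)) ?Z Mod carrier (subgroup_generated (?C (Suc k)) ?Z)"
    by (simp add: reduced_homology_group_def)
  interpret G: group "subgroup_generated (?C (Suc k)) ?Z"
    by (rule d.G.group_subgroup_generated)
  have "group (reduced_homology_group ?K r k)"
    by (rule group_reduced_homology_group[OF order_complex_subset])
  moreover have "carrier (reduced_homology_group ?K r k) \<subseteq>
      {carrier (subgroup_generated (?C (Suc k)) ?Z)}"
    unfolding eq FactGroup_def RCOSETS_def
    using G.coset_join2[OF _ G.subgroup_self] by auto
  ultimately show ?thesis
    by (auto simp: group.trivial_group_alt)
qed

section \<open>Posets in which bounded pairs have joins\<close>

text \<open>Joins are demanded only under a common upper bound: there may be no top element, and the
  condition survives passing to up-closed subsets.\<close>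

definition join_poset :: "('v \<Rightarrow> 'v \<Rightarrow> bool) \<Rightarrow> 'v set \<Rightarrow> bool" where
  "join_poset r P \<longleftrightarrow> finite P \<and> reflp_on P r \<and> transp_on P r \<and> antisymp_on P r \<and>
     (\<forall>x\<in>P. \<forall>y\<in>P. \<forall>z\<in>P. r x z \<and> r y z \<longrightarrow>
       (\<exists>j\<in>P. r x j \<and> r y j \<and> (\<forall>w\<in>P. r x w \<and> r y w \<longrightarrow> r j w)))"

lemma join_poset_up_closed:
  assumes "join_poset r P" "up_closed_in r P Q"
  shows "join_poset r Q"
proof -
  have Q: "Q \<subseteq> P" using assms(2) by (simp add: up_closed_in_def)
  have "\<exists>j\<in>Q. r x j \<and> r y j \<and> (\<forall>w\<in>Q. r x w \<and> r y w \<longrightarrow> r j w)"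
    if xyz: "x \<in> Q" "y \<in> Q" "z \<in> Q" "r x z" "r y z" for x y z
  proof -
    obtain j where "j \<in> P" "r x j" "r y j" "\<forall>w\<in>P. r x w \<and> r y w \<longrightarrow> r j w"
      using assms(1) subsetD[OF Q] xyz unfolding join_poset_def by (metis (no_types))
    then show ?thesis using assms(2) Q xyz unfolding up_closed_in_def by blast
  qed
  then show ?thesis
    using assms(1) Q unfolding join_poset_def
    by (auto intro: finite_subset reflp_on_subset transp_on_subset antisymp_on_subset)
qed

text \<open>When one generator is split off, its intersection with the rest has at most
  \<open>card M - 1\<close> generators and is needed one dimension lower, so the bound on
  \<open>card M\<close> persists.\<close>

lemma acyclic_at_generated:
  assumes "join_poset r P" "finite M" "M \<subseteq> P" "card M \<le> Suc n" "\<forall>x\<in>P. \<exists>m\<in>M. r m x"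
  shows "acyclic_at r P (Suc n)"
  using assms
\<comment> \<open>\<open>P\<close> and \<open>n\<close> vary: the hypothesis is used for
  \<open>?A\<close> with the same \<open>n\<close> and for \<open>?A \<inter> ?B\<close> with its
  predecessor.\<close>
proof (induction "card M" arbitrary: M P n rule: less_induct)
  case less
  note P = less.prems(1)
  have anti: "antisymp_on P r" and trans: "transp_on P r" and refl: "reflp_on P r"
    using P by (auto simp: join_poset_def)
  consider "P = {}" | m where "M = {m}" | m M' where "M = insert m M'" "m \<notin> M'" "M' \<noteq> {}"
    using less.prems(5) by (metis ex_in_conv mk_disjoint_insert)
  then show ?case
  proof cases
    case 1
    then show ?thesis by (simp add: acyclic_at_empty)
  next
    case (2 m)
    then show ?thesis using acyclic_at_cone[OF anti] less.prems by auto
  next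
    case (3 m M')
    have sub: "m \<in> P" "M' \<subseteq> P" "finite M'" using less.prems 3 by auto
    have card: "card M = Suc (card M')" "card M' \<noteq> 0"
      using 3 sub by auto
    \<comment> \<open>There are at least two generators, so the index \<open>n\<close> of the
      intersection is again a successor.\<close>
    then have "card M' \<le> n" "n \<noteq> 0" using less.prems(4) by linarith+
    then obtain n' where n: "n = Suc n'" "card M' \<le> n"
      using not0_implies_Suc by blast
    let ?A = "{x\<in>P. \<exists>m'\<in>M'. r m' x}" and ?B = "{x\<in>P. r m x}"
    have Un: "P = ?A \<union> ?B" using less.prems(5) 3 by auto
    have A: "up_closed_in r P ?A" and B: "up_closed_in r P ?B"
      and AB: "up_closed_in r P (?A \<inter> ?B)"
      using trans sub unfolding up_closed_in_def transp_on_def by blast+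
    have acA: "acyclic_at r ?A (Suc n)"
    proof (rule less.hyps[of M'])
      show "M' \<subseteq> ?A" using sub refl by (auto simp: reflp_on_def)
    qed (use card n sub join_poset_up_closed[OF P A] in auto)
    have acB: "acyclic_at r ?B (Suc n)"
      by (rule acyclic_at_cone[of _ _ m])
        (use antisymp_on_subset[OF anti] sub refl in \<open>auto simp: reflp_on_def\<close>)
    \<comment> \<open>Only generators bounded together with \<open>m\<close> contribute to
      \<open>?A \<inter> ?B\<close>, which is generated by their joins \<open>J m'\<close> with
      \<open>m\<close>.\<close>
    define M1 where "M1 = {m'\<in>M'. \<exists>z\<in>P. r m' z \<and> r m z}"
    have "\<exists>j\<in>P. r m' j \<and> r m j \<and> (\<forall>w\<in>P. r m' w \<and> r m w \<longrightarrow> r j w)" if "m' \<in> M1" for m'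
      using that P sub unfolding join_poset_def M1_def by blast
    then obtain J where J: "\<And>m'. m' \<in> M1 \<Longrightarrow> J m' \<in> P \<and> r m' (J m') \<and> r m (J m') \<and>
        (\<forall>w\<in>P. r m' w \<and> r m w \<longrightarrow> r (J m') w)"
      by metis
    have M1: "M1 \<subseteq> M'" "finite M1" using sub by (auto simp: M1_def)
    have card_J: "card (J ` M1) \<le> card M'"
      using card_image_le[OF M1(2)] card_mono[OF sub(3) M1(1)] by (meson le_trans)
    have "acyclic_at r (?A \<inter> ?B) (Suc n')"
    proof (rule less.hyps[of "J ` M1"])
      show "J ` M1 \<subseteq> ?A \<inter> ?B" using J M1 by blast
      show "\<forall>x\<in>?A \<inter> ?B. \<exists>m\<in>J ` M1. r m x" using J by (auto simp: M1_def)
    qed (use card card_J n M1 join_poset_up_closed[OF P AB] in auto)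
    then show ?thesis
      using acyclic_at_Un[of r ?A n ?B] acA acB A B Un n by simp
  qed
qed

section \<open>Counting maximal chains\<close>

text \<open>As in \<open>acyclic_at\<close>, \<open>n\<close> counts elements, so the length is at
  least \<open>n - 1\<close>.\<close>

definition long_maxchains :: "('v \<Rightarrow> 'v \<Rightarrow> bool) \<Rightarrow> 'v set \<Rightarrow> nat \<Rightarrow> 'v set set" where
  "long_maxchains r P n = {C. pred_on.maxchain P r C \<and> n \<le> card C}"

lemma long_maxchains_subset_Pow: "long_maxchains r P n \<subseteq> Pow P"
  by (auto simp: long_maxchains_def pred_on.maxchain_def pred_on.chain_def)

lemma finite_long_maxchains: "finite P \<Longrightarrow> finite (long_maxchains r P n)"
  by (meson finite_Pow_iff finite_subset long_maxchains_subset_Pow)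

section \<open>Maximal chains after removal of an element\<close>

lemma chain_Diff:
  "pred_on.chain P r S \<Longrightarrow> pred_on.chain (P - {m}) r (S - {m})"
  by (auto simp: pred_on.chain_def)

text \<open>A maximal chain of \<open>P - {m}\<close> is either maximal in \<open>P\<close> or
  becomes so when \<open>m\<close> is inserted. As \<open>m\<close> was absent before, this
  assignment is injective.\<close>

lemma card_long_maxchains_remove:
  assumes P: "finite P" "m \<in> P"
  shows "card (long_maxchains r (P - {m}) n) \<le> card (long_maxchains r P n)"
proof (rule card_inj_on_le)
  let ?f = "\<lambda>C. if pred_on.maxchain P r C then C else insert m C"
  have notin: "m \<notin> C" if "C \<in> long_maxchains r (P - {m}) n" for C
    using that long_maxchains_subset_Pow by blast
  then show "inj_on ?f (long_maxchains r (P - {m}) n)"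
    by (auto simp: inj_on_def insert_ident split: if_splits)
  show "?f ` long_maxchains r (P - {m}) n \<subseteq> long_maxchains r P n"
  proof (intro image_subsetI)
    fix C assume C: "C \<in> long_maxchains r (P - {m}) n"
    then have ch: "pred_on.chain (P - {m}) r C" and n: "n \<le> card C"
      and mx: "\<And>S. pred_on.chain (P - {m}) r S \<Longrightarrow> C \<subseteq> S \<Longrightarrow> S = C"
      by (auto simp: long_maxchains_def pred_on.maxchain_def)
    have "finite C" using ch P(1) by (auto simp: pred_on.chain_def intro: finite_subset)
    have "pred_on.maxchain P r (insert m C)" if not: "\<not> pred_on.maxchain P r C"
    proof -
      \<comment> \<open>Without \<open>m\<close>, a larger chain \<open>S\<close> of
        \<open>P\<close> is a chain of \<open>P - {m}\<close> containing \<open>C\<close>, hence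
        equal to \<open>C\<close>.\<close>
      have eq: "S = insert m C" if "pred_on.chain P r S" "C \<subset> S" for S
        using mx[OF chain_Diff[OF that(1)]] that(2) notin[OF C] by blast
      have "pred_on.chain P r C" using ch by (auto simp: pred_on.chain_def)
      with not obtain S where "pred_on.chain P r S" "C \<subset> S"
        by (auto simp: pred_on.maxchain_def)
      with eq show ?thesis
        unfolding pred_on.maxchain_def by (metis psubset_trans psubset_eq)
    qed
    then show "?f C \<in> long_maxchains r P n"
      using C n \<open>finite C\<close> card_insert_le[of C m] by (auto simp: long_maxchains_def)
  qed
qed (rule finite_long_maxchains[OF P(1)])

text \<open>All other elements of a chain through the minimal \<open>m\<close> lie strictly above
  \<open>m\<close>, so extensions can be tested in the strict up-set.\<close>

lemma insert_minimal_long_maxchains: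
  assumes m: "m \<in> P" "\<forall>x\<in>P. r x m \<longrightarrow> x = m" and P: "finite P"
    and C: "C \<in> long_maxchains r {x\<in>P. r m x \<and> x \<noteq> m} n"
  shows "insert m C \<in> long_maxchains r P (Suc n)"
proof -
  let ?Q = "{x\<in>P. r m x \<and> x \<noteq> m}"
  have sub: "C \<subseteq> ?Q" using C long_maxchains_subset_Pow by blast
  then have fin: "finite C" "m \<notin> C" using P by (auto intro: finite_subset)
  have ch: "pred_on.chain ?Q r C" and n: "n \<le> card C"
    and mx: "\<And>S. pred_on.chain ?Q r S \<Longrightarrow> C \<subseteq> S \<Longrightarrow> S = C"
    using C by (auto simp: long_maxchains_def pred_on.maxchain_def)
  have "S = insert m C" if S: "pred_on.chain P r S" "insert m C \<subseteq> S" for S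
  proof -
    have "pred_on.chain ?Q r (S - {m})"
      using S m unfolding pred_on.chain_def by blast
    then show ?thesis using mx[of "S - {m}"] S(2) fin(2) by blast
  qed
  moreover have "pred_on.chain P r (insert m C)"
    using ch sub m(1) unfolding pred_on.chain_def by auto
  ultimately have "pred_on.maxchain P r (insert m C)"
    unfolding pred_on.maxchain_def by blast
  then show ?thesis using n fin by (simp add: long_maxchains_def)
qed

section \<open>The counting induction\<close>

lemma exists_minimal_below:
  assumes "join_poset r P" "x \<in> P"
  shows "\<exists>m\<in>P. r m x \<and> (\<forall>y\<in>P. r y m \<longrightarrow> y = m)"
  using assms(2)
proof (induction "card {y\<in>P. r y x}" arbitrary: x rule: less_induct)
  case less
  have P: "finite P" "reflp_on P r" "transp_on P r" "antisymp_on P r"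
    using assms by (auto simp: join_poset_def)
  show ?case
  proof (cases "\<forall>y\<in>P. r y x \<longrightarrow> y = x")
    case True
    then show ?thesis using P less.prems by (auto simp: reflp_on_def)
  next
    case False
    then obtain y where y: "y \<in> P" "r y x" "y \<noteq> x" by blast
    then have "\<not> r x y" using P less.prems by (auto simp: antisymp_on_def)
    moreover have "r x x" using P less.prems by (auto simp: reflp_on_def)
    moreover have "{z\<in>P. r z y} \<subseteq> {z\<in>P. r z x}"
      using P y less.prems unfolding transp_on_def by blast
    ultimately have "{z\<in>P. r z y} \<subset> {z\<in>P. r z x}" using less.prems by blast
    then have "card {z\<in>P. r z y} < card {z\<in>P. r z x}"
      using P by (intro psubset_card_mono) auto
    from less.hyps[OF this y(1)] show ?thesis
      using P y less.prems unfolding transp_on_def by blast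
  qed
qed

theorem fact_le_card_long_maxchains:
  assumes "join_poset r P" "\<not> acyclic_at r P n"
  shows "fact (Suc n) \<le> card (long_maxchains r P n)"
  using assms
proof (induction "card P" arbitrary: P n rule: less_induct)
  case less
  note P = less.prems(1)
  have fin: "finite P" and anti: "antisymp_on P r" and trans: "transp_on P r" and refl: "reflp_on P r"
    using P by (auto simp: join_poset_def)
  show ?case
  proof (cases n)
    \<comment> \<open>Since 1! = 1, a single maximal chain of any size suffices.\<close>
    case 0
    obtain C where "pred_on.maxchain P r C"
      using pred_on.Hausdorff by blast
    then have "long_maxchains r P 0 \<noteq> {}" by (auto simp: long_maxchains_def)
    then show ?thesis using 0 finite_long_maxchains[OF fin] by (simp add: Suc_le_eq card_gt_0_iff)
  next
    case (Suc l)
    define Min where "Min = {m\<in>P. \<forall>x\<in>P. r x m \<longrightarrow> x = m}"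
    let ?U = "\<lambda>m. {x\<in>P. r m x \<and> x \<noteq> m}"
    have Min_sub: "Min \<subseteq> P" "finite Min" using fin by (auto simp: Min_def)
    have U: "up_closed_in r P (?U m)" if "m \<in> P" for m
      using that trans anti unfolding up_closed_in_def transp_on_def antisymp_on_def by blast
    have card_less: "card Q < card P" if "Q \<subseteq> P" "m \<in> P" "m \<notin> Q" for Q m
      using that fin by (intro psubset_card_mono) auto
    show ?thesis
    proof (cases "\<exists>m\<in>Min. acyclic_at r (?U m) l")
      case True
      then obtain m where m: "m \<in> P" "\<forall>x\<in>P. r x m \<longrightarrow> x = m" "acyclic_at r (?U m) l"
        by (auto simp: Min_def)
      let ?A = "P - {m}" and ?B = "{x\<in>P. r m x}"
      have un: "?A \<union> ?B = P" and int: "?A \<inter> ?B = ?U m"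
        using m refl by (auto simp: reflp_on_def)
      \<comment> \<open>\<open>?A\<close> is up-closed because \<open>m\<close> is minimal.\<close>
      have A: "up_closed_in r P ?A" and B: "up_closed_in r P ?B"
        using m trans unfolding up_closed_in_def transp_on_def by blast+
      have "acyclic_at r ?B (Suc l)"
        by (rule acyclic_at_cone[of _ _ m])
          (use antisymp_on_subset[OF anti] m refl in \<open>auto simp: reflp_on_def\<close>)
      then have "\<not> acyclic_at r ?A n"
        using less.prems(2) acyclic_at_Un[of r ?A l ?B] A B m(3) unfolding Suc un int by blast
      then have "fact (Suc n) \<le> card (long_maxchains r ?A n)"
        by (intro less.hyps card_less[OF _ m(1)] join_poset_up_closed[OF P A]) auto
      then show ?thesis
        using card_long_maxchains_remove[OF fin m(1)] le_trans by blast
    next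
      case False
      have count: "fact n \<le> card (long_maxchains r (?U m) l)" if "m \<in> Min" for m
        unfolding Suc
        by (intro less.hyps card_less[of _ m] join_poset_up_closed[OF P U])
          (use that Min_sub False in auto)
      have "Suc n \<le> card Min"
      proof (rule ccontr)
        assume "\<not> Suc n \<le> card Min"
        then have "acyclic_at r P (Suc l)"
          using exists_minimal_below[OF P]
          by (intro acyclic_at_generated[OF P Min_sub(2,1)]) (auto simp: Suc Min_def)
        then show False using less.prems(2) Suc by simp
      qed
      \<comment> \<open>The maximal chains of \<open>P\<close> starting at \<open>m\<close>. They
        contain no other minimal element, so these families are disjoint and their sizes add
        up.\<close>
      let ?F = "\<lambda>m. insert m ` long_maxchains r (?U m) l"
      have inU: "C \<subseteq> ?U m" if "C \<in> long_maxchains r (?U m) l" for C m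
        using that long_maxchains_subset_Pow by blast
      have "card (?F m) = card (long_maxchains r (?U m) l)" for m
        by (intro card_image) (use inU in \<open>unfold inj_on_def, blast\<close>)
      moreover have "?F m \<inter> ?F m' = {}" if "m \<in> Min" "m' \<in> Min" "m \<noteq> m'" for m m'
      proof -
        have "m \<notin> D" if "D \<in> ?F m'" for D
          using that inU[of _ m'] \<open>m \<in> Min\<close> \<open>m' \<in> Min\<close> \<open>m \<noteq> m'\<close> unfolding Min_def by blast
        then show ?thesis by blast
      qed
      ultimately have card_UN: "card (\<Union>m\<in>Min. ?F m) = (\<Sum>m\<in>Min. card (long_maxchains r (?U m) l))"
        using Min_sub fin by (subst card_UN_disjoint) (auto simp: finite_long_maxchains)
      have "fact (Suc n) \<le> card Min * fact n"
        using \<open>Suc n \<le> card Min\<close> by (simp only: fact_Suc of_nat_id mult_le_mono1)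
      also have "\<dots> \<le> (\<Sum>m\<in>Min. card (long_maxchains r (?U m) l))"
        using sum_mono[of Min "\<lambda>_. fact n", OF count] by simp
      also have "\<dots> \<le> card (long_maxchains r P n)"
        unfolding card_UN[symmetric]
      proof (rule card_mono[OF finite_long_maxchains[OF fin]])
        show "(\<Union>m\<in>Min. ?F m) \<subseteq> long_maxchains r P n"
          using insert_minimal_long_maxchains[OF _ _ fin] unfolding Suc Min_def by blast
      qed
      finally show ?thesis .
    qed
  qed
qed

section \<open>The doubly-labeled poset\<close>

text \<open>\<open>rel_phi\<close> and \<open>rel_psi\<close> form an antitone Galois connection.
  The join of \<open>p\<close> and \<open>q\<close> has second label
  \<open>snd p \<inter> snd q\<close>, which is nonempty because it contains the nonempty second
  label of an upper bound.\<close>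

lemma join_poset_doubly_labeled_poset:
  assumes "finite X" "finite Y"
  shows "join_poset label_le (doubly_labeled_poset X Y R)"
proof -
  let ?P = "doubly_labeled_poset X Y R" and ?phi = "rel_phi X Y R" and ?psi = "rel_psi X Y R"
  have P: "fst p = ?psi (snd p)" "snd p = ?phi (fst p)" "fst p \<noteq> {}" "snd p \<noteq> {}"
      "fst p \<subseteq> X" "snd p \<subseteq> Y" if "p \<in> ?P" for p
    using that by (auto simp: doubly_labeled_poset_def)
  have anti: "?phi \<tau> \<subseteq> ?phi \<sigma>" if "\<sigma> \<subseteq> \<tau>" for \<sigma> \<tau>
    using that by (auto simp: rel_phi_def)
  have anti': "?psi \<tau> \<subseteq> ?psi \<sigma>" if "\<sigma> \<subseteq> \<tau>" for \<sigma> \<tau>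
    using that by (auto simp: rel_psi_def)
  have closure: "\<gamma> \<subseteq> ?phi (?psi \<gamma>)" if "\<gamma> \<subseteq> Y" for \<gamma>
    using that by (auto simp: rel_phi_def rel_psi_def)
  have "\<exists>j\<in>?P. label_le p j \<and> label_le q j \<and> (\<forall>w\<in>?P. label_le p w \<and> label_le q w \<longrightarrow> label_le j w)"
    if p: "p \<in> ?P" and q: "q \<in> ?P" and z: "z \<in> ?P" and le: "label_le p z" "label_le q z" for p q z
  proof -
    define \<gamma> where "\<gamma> = snd p \<inter> snd q"
    have lower: "snd w \<subseteq> \<gamma>" if "w \<in> ?P" "label_le p w" "label_le q w" for w
      using that p q P(2) anti unfolding \<gamma>_def label_le_def by (metis Int_greatest)
    have up: "fst p \<subseteq> ?psi \<gamma>" "fst q \<subseteq> ?psi \<gamma>"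
      using P(1)[OF p] P(1)[OF q] anti'[of \<gamma> "snd p"] anti'[of \<gamma> "snd q"] by (auto simp: \<gamma>_def)
    have "\<gamma> \<subseteq> Y" using P(6)[OF p] by (auto simp: \<gamma>_def)
    \<comment> \<open>\<open>?psi \<gamma>\<close> contains both first labels, so its image under
      \<open>?phi\<close> lies in both second labels.\<close>
    have "?phi (?psi \<gamma>) \<subseteq> \<gamma>"
      using anti[OF up(1)] anti[OF up(2)] P(2)[OF p] P(2)[OF q] by (auto simp: \<gamma>_def)
    then have "?phi (?psi \<gamma>) = \<gamma>" using closure[OF \<open>\<gamma> \<subseteq> Y\<close>] by blast
    moreover have "\<gamma> \<noteq> {}" using lower[OF z le] P(4)[OF z] by blast
    moreover have "?psi \<gamma> \<noteq> {}" using up P(3)[OF p] by blast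
    ultimately have "(?psi \<gamma>, \<gamma>) \<in> ?P"
      using \<open>\<gamma> \<subseteq> Y\<close> by (auto simp: doubly_labeled_poset_def rel_psi_def)
    moreover have "?psi \<gamma> \<subseteq> fst w" if "w \<in> ?P" "label_le p w" "label_le q w" for w
      using anti'[OF lower[OF that]] P(1)[OF that(1)] by simp
    ultimately show ?thesis
      using up by (intro bexI[of _ "(?psi \<gamma>, \<gamma>)"]) (auto simp: label_le_def)
  qed
  moreover have "finite ?P"
    by (rule finite_subset[of _ "Pow X \<times> Pow Y"])
      (use assms in \<open>auto simp: doubly_labeled_poset_def\<close>)
  \<comment> \<open>\<open>label_le\<close> compares first labels only, but these determine the
    second ones through \<open>?phi\<close>.\<close>
  moreover have "antisymp_on ?P label_le"
    unfolding antisymp_on_def label_le_def using P(2) by (metis prod.expand subset_antisym)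
  ultimately show ?thesis
    unfolding join_poset_def by (auto simp: reflp_on_def transp_on_def label_le_def)
qed

theorem corollary27:
  fixes X :: "'a set" and Y :: "'b set" and R :: "('a \<times> 'b) set" and k :: nat
  assumes "finite X" and "finite Y" and "R \<subseteq> X \<times> Y"
    and "X \<noteq> {}" and "Y \<noteq> {}"
    and "\<not> trivial_group
           (reduced_homology_group (order_complex (doubly_labeled_poset X Y R) label_le) label_le k)"
  shows "fact (k + 2) \<le>
           card {C. pred_on.maxchain (doubly_labeled_poset X Y R) label_le C \<and> int k \<le> chain_length C}"
proof -
  let ?P = "doubly_labeled_poset X Y R"
  \<comment> \<open>Index \<open>Suc k\<close> stands for dimension \<open>k\<close> in homology and
    for length at least \<open>k\<close> on the side of chains.\<close>
  have "\<not> acyclic_at label_le ?P (Suc k)"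
    using assms(6) trivial_reduced_homology_group by blast
  then have "fact (Suc (Suc k)) \<le> card (long_maxchains label_le ?P (Suc k))"
    by (rule fact_le_card_long_maxchains[OF join_poset_doubly_labeled_poset[OF assms(1,2)]])
  also have "long_maxchains label_le ?P (Suc k) =
      {C. pred_on.maxchain ?P label_le C \<and> int k \<le> chain_length C}"
    by (auto simp: long_maxchains_def chain_length_def)
  finally show ?thesis by simp
qed

end
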